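(* For every integer $n>1$, the $n$-dimensional Bohr radius $K_n$ satisfies $$\frac{1}{3\sqrt{n}} < K_n < \frac{2\sqrt{\log n}}{\sqrt{n}}.$$
   Context: Multi-index notation: $\alpha=(\alpha_1,\dots,\alpha_n)$ denotes an $n$-tuple of nonnegative integers, $z=(z_1,\dots,z_n)\in\mathbb{C}^n$, and $z^\alpha=z_1^{\alpha_1}z_2^{\alpha_2}\cdots z_n^{\alpha_n}$. An $n$-variable power series is a series $\sum_\alpha c_\alpha z^\alpha$ with complex coefficients $c_\alpha$, the sum being over all multi-indices $\alpha$. The unit polydisc is $\{z\in\mathbb{C}^n:\max_{1\le j\le n}|z_j|<1\}$. The $n$-dimensional Bohr radius $K_n$ is the largest number such that the following holds: whenever a power series $\sum_\alpha c_\alpha z^\alpha$ converges in the unit polydisc and satisfies $\left|\sum_\alpha c_\alpha z^\alpha\right|<1$ for all $z$ in the unit polydisc, then $\sum_\alpha |c_\alpha z^\alpha|<1$ for all $z$ with $\max_{1\le j\le n}|z_j|<K_n$. Here $\log$ is the natural logarithm. *)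

theory Defs
  imports "HOL-Analysis.Analysis"
begin

text \<open>
  The coordinates \<open>1, \<dots>, n\<close> are numbered \<open>0, \<dots>, n - 1\<close>. A point of \<open>n\<close>-dimensional complex space
  is a function \<open>z :: nat \<Rightarrow> complex\<close> of which only the values at \<open>j < n\<close> matter.
\<close>

definition multi_indices :: "nat \<Rightarrow> (nat \<Rightarrow> nat) set" where
  "multi_indices n = ({..<n} \<rightarrow>\<^sub>E UNIV)"

definition monomial :: "nat \<Rightarrow> (nat \<Rightarrow> complex) \<Rightarrow> (nat \<Rightarrow> nat) \<Rightarrow> complex" where
  "monomial n z \<alpha> = (\<Prod>j<n. z j ^ \<alpha> j)"

definition polydisc :: "nat \<Rightarrow> real \<Rightarrow> (nat \<Rightarrow> complex) set" where
  "polydisc n r = {z. \<forall>j<n. cmod (z j) < r}"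

text \<open>
  Convergence of a multiple power series at a point is unconditional summability over the set of
  multi-indices. As \<open>infsum\<close> is 0 for families that are not summable, summability of the absolute
  values has to be part of the conclusion of \<open>bohr_property\<close>.
\<close>

definition bohr_property :: "nat \<Rightarrow> real \<Rightarrow> bool" where
  "bohr_property n r \<longleftrightarrow>
     (\<forall>c :: (nat \<Rightarrow> nat) \<Rightarrow> complex.
        (\<forall>z \<in> polydisc n 1.
           (\<lambda>\<alpha>. c \<alpha> * monomial n z \<alpha>) summable_on multi_indices n \<and>
           cmod (\<Sum>\<^sub>\<infinity>\<alpha>\<in>multi_indices n. c \<alpha> * monomial n z \<alpha>) < 1)
        \<longrightarrow>
        (\<forall>z \<in> polydisc n r.
           (\<lambda>\<alpha>. cmod (c \<alpha> * monomial n z \<alpha>)) summable_on multi_indices n \<and>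
           (\<Sum>\<^sub>\<infinity>\<alpha>\<in>multi_indices n. cmod (c \<alpha> * monomial n z \<alpha>)) < 1))"

definition bohr_radius :: "nat \<Rightarrow> real" where
  "bohr_radius n = (GREATEST r. bohr_property n r)"

lemma bohr_property_le_1:
  assumes "n > 0" and r: "bohr_property n r"
  shows "r \<le> 1"
proof (rule ccontr)
  assume "\<not> r \<le> 1"
  define e :: "nat \<Rightarrow> nat" where "e = restrict (\<lambda>j. if j = 0 then 1 else 0) {..<n}"
  define c :: "(nat \<Rightarrow> nat) \<Rightarrow> complex" where "c = (\<lambda>\<alpha>. if \<alpha> = e then 1 else 0)"
  have e: "e \<in> multi_indices n"
    by (auto simp: multi_indices_def e_def)
  have mono: "monomial n z e = z 0" for z
  proof -
    have "monomial n z e = (\<Prod>j<n. if j = 0 then z j else 1)"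
      unfolding monomial_def e_def by (intro prod.cong) auto
    also have "\<dots> = z 0"
      using \<open>n > 0\<close> by (simp add: prod.delta)
    finally show ?thesis .
  qed
  have hs: "((\<lambda>\<alpha>. c \<alpha> * monomial n z \<alpha>) has_sum z 0) (multi_indices n)" for z
  proof -
    have "((\<lambda>\<alpha>. c \<alpha> * monomial n z \<alpha>) has_sum (\<Sum>\<alpha>\<in>{e}. c \<alpha> * monomial n z \<alpha>)) {e}"
      by (intro has_sum_finite) auto
    then have "((\<lambda>\<alpha>. c \<alpha> * monomial n z \<alpha>) has_sum z 0) {e}"
      by (simp add: c_def mono)
    then show ?thesis
      by (rule has_sum_cong_neutral[THEN iffD1, rotated -1]) (use e in \<open>auto simp: c_def\<close>)
  qed
  have hs': "((\<lambda>\<alpha>. cmod (c \<alpha> * monomial n z \<alpha>)) has_sum cmod (z 0)) (multi_indices n)" for z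
  proof -
    have "((\<lambda>\<alpha>. cmod (c \<alpha> * monomial n z \<alpha>)) has_sum (\<Sum>\<alpha>\<in>{e}. cmod (c \<alpha> * monomial n z \<alpha>))) {e}"
      by (intro has_sum_finite) auto
    then have "((\<lambda>\<alpha>. cmod (c \<alpha> * monomial n z \<alpha>)) has_sum cmod (z 0)) {e}"
      by (simp add: c_def mono)
    then show ?thesis
      by (rule has_sum_cong_neutral[THEN iffD1, rotated -1]) (use e in \<open>auto simp: c_def\<close>)
  qed
  have "\<forall>z \<in> polydisc n 1. (\<lambda>\<alpha>. c \<alpha> * monomial n z \<alpha>) summable_on multi_indices n \<and>
           cmod (\<Sum>\<^sub>\<infinity>\<alpha>\<in>multi_indices n. c \<alpha> * monomial n z \<alpha>) < 1"
    using \<open>n > 0\<close> by (auto simp: polydisc_def infsumI[OF hs] intro: has_sum_imp_summable[OF hs])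
  then have "\<forall>z \<in> polydisc n r. (\<Sum>\<^sub>\<infinity>\<alpha>\<in>multi_indices n. cmod (c \<alpha> * monomial n z \<alpha>)) < 1"
    using r unfolding bohr_property_def by blast
  moreover have "(\<lambda>_. 1) \<in> polydisc n r"
    using \<open>\<not> r \<le> 1\<close> by (simp add: polydisc_def)
  ultimately have "(\<Sum>\<^sub>\<infinity>\<alpha>\<in>multi_indices n. cmod (c \<alpha> * monomial n (\<lambda>_. 1) \<alpha>)) < 1"
    by blast
  then show False
    using infsumI[OF hs'[of "\<lambda>_. 1"]] by simp
qed

lemma polydisc_Sup_subset:
  assumes "n > 0" and "S \<noteq> {}" and "bdd_above S" and "z \<in> polydisc n (Sup S)"
  shows "\<exists>r\<in>S. z \<in> polydisc n r"
proof -
  have "Max ((\<lambda>j. cmod (z j)) ` {..<n}) < Sup S"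
    using assms(1,4) by (subst Max_less_iff) (auto simp: polydisc_def)
  then obtain r where r: "r \<in> S" "Max ((\<lambda>j. cmod (z j)) ` {..<n}) < r"
    using assms(2,3) less_cSup_iff by blast
  then have "z \<in> polydisc n r"
    using assms(1) by (subst (asm) Max_less_iff) (auto simp: polydisc_def)
  with r show ?thesis by blast
qed

text \<open>For \<open>n \<ge> 1\<close> the largest number in the definition of \<open>bohr_radius\<close> exists.\<close>

lemma bohr_radius_greatest:
  assumes "n > 0"
  shows "bohr_property n (bohr_radius n)"
    and "bohr_property n r \<Longrightarrow> r \<le> bohr_radius n"
proof -
  define S where "S = {r. bohr_property n r}"
  have bdd: "bdd_above S"
    using bohr_property_le_1[OF assms] by (auto simp: S_def intro!: bdd_aboveI[of _ 1])
  have "polydisc n 0 = {}"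
    using assms by (auto simp: polydisc_def)
  then have "0 \<in> S"
    by (simp add: S_def bohr_property_def)
  then have ne: "S \<noteq> {}"
    by blast
  have SupS: "bohr_property n (Sup S)"
    unfolding bohr_property_def
  proof (intro allI impI ballI, goal_cases)
    case (1 c z)
    obtain r where "r \<in> S" "z \<in> polydisc n r"
      using polydisc_Sup_subset[OF assms ne bdd 1(2)] by blast
    with 1(1) show ?case
      unfolding S_def bohr_property_def by blast
  qed
  have le: "r \<le> Sup S" if "bohr_property n r" for r
    using that bdd by (intro cSup_upper) (auto simp: S_def)
  have eq: "bohr_radius n = Sup S"
    unfolding bohr_radius_def using SupS le by (rule Greatest_equality)
  show "bohr_property n (bohr_radius n)"
    using SupS eq by simp
  show "bohr_property n r \<Longrightarrow> r \<le> bohr_radius n"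
    using le eq by simp
qed

end

theory Submission
  imports Defs
begin

text \<open>
  \<^bold>\<open>The lower bound.\<close> Let \<open>f\<close> be a power series bounded by 1 and let \<open>a\<close> be the absolute value of its
  constant term. Restricted to a complex line through the origin, \<open>f\<close> is a function of one variable,
  and F. Wiener's inequality (\<open>wiener_coefficient_bound\<close>) bounds each homogeneous part of positive
  degree by \<open>1 - a\<^sup>2\<close> on the torus. By Parseval's identity the same number bounds the \<open>\<ell>\<^sup>2\<close> norm of the
  coefficients of degree \<open>k\<close> (\<open>sum_square_homogeneous_coefficients\<close>), so by Cauchy--Schwarz the terms of
  degree \<open>k\<close> at radius \<open>r\<close> add up to at most \<open>(1 - a\<^sup>2) r\<^sup>k\<close> times the square root of the number of
  multi-indices of degree \<open>k\<close>. As this number is at most \<open>n\<^sup>k\<close>, the radius \<open>r = 1 / (3 sqrt n)\<close> gives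
  at most \<open>a + (1 - a\<^sup>2) / 2 < 1\<close> in total. There is room for a larger radius, because from degree two
  on there are considerably fewer than \<open>n\<^sup>k\<close> multi-indices (\<open>bohr_property_lower\<close>).

  \<^bold>\<open>The upper bound.\<close> An explicit polynomial with unimodular coefficients and small supremum takes the
  place of a random one. Split the variables into \<open>k\<close> blocks of \<open>m = n div k\<close> variables, and couple
  consecutive blocks by the matrix of the discrete Fourier transform of order \<open>m\<close>. The resulting
  multilinear form has \<open>m\<^sup>k\<close> coefficients of absolute value 1. As the matrix is \<open>sqrt m\<close> times a unitary
  matrix, the form is bounded by \<open>sqrt (m\<^sup>k\<^sup>+\<^sup>1)\<close> on the polydisc (\<open>norm_chain_form_le\<close>). Hence the
  Bohr radius \<open>K\<close> satisfies \<open>(m K)\<^sup>k \<le> sqrt (m\<^sup>k\<^sup>+\<^sup>1)\<close>, that is, \<open>(m K\<^sup>2)\<^sup>k \<le> m\<close>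
  (\<open>bohr_property_imp_square_le\<close>). For \<open>k\<close> near \<open>ln n\<close> this says that \<open>K\<^sup>2\<close> is at most about
  \<open>exp 1 * ln n / n\<close>, and \<open>exp 1 < 4\<close>.

  All averages over circles and tori are taken over roots of unity, where Parseval's identity for
  polynomials is exact.
\<close>

section \<open>Parseval's identity on roots of unity\<close>

text \<open>
Every averaging over a circle or torus below is over finitely many points, so that Parseval's
identity is the algebraic fact that orthogonal vectors of equal length satisfy Pythagoras.
\<close>

lemma parseval_orthogonal:
  fixes \<phi> :: "'a \<Rightarrow> 'b \<Rightarrow> complex"
  assumes "finite A"
    and orth: "\<And>a a'. a \<in> A \<Longrightarrow> a' \<in> A \<Longrightarrow>
      (\<Sum>b\<in>B. \<phi> a b * cnj (\<phi> a' b)) = (if a = a' then of_real K else 0)"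
  shows "(\<Sum>b\<in>B. (cmod (\<Sum>a\<in>A. d a * \<phi> a b))\<^sup>2) = K * (\<Sum>a\<in>A. (cmod (d a))\<^sup>2)"
proof -
  have "complex_of_real (\<Sum>b\<in>B. (cmod (\<Sum>a\<in>A. d a * \<phi> a b))\<^sup>2)
      = (\<Sum>b\<in>B. (\<Sum>a\<in>A. \<Sum>a'\<in>A. d a * cnj (d a') * (\<phi> a b * cnj (\<phi> a' b))))"
    by (simp add: complex_norm_square sum_product mult_ac del: of_real_power)
  also have "\<dots> = (\<Sum>a\<in>A. \<Sum>a'\<in>A. d a * cnj (d a') * (\<Sum>b\<in>B. \<phi> a b * cnj (\<phi> a' b)))"
    by (subst sum.swap, intro sum.cong refl, subst sum.swap) (simp add: sum_distrib_left)
  also have "\<dots> = (\<Sum>a\<in>A. \<Sum>a'\<in>A. if a = a' then d a * cnj (d a') * of_real K else 0)"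
    by (intro sum.cong refl) (auto simp: orth)
  also have "\<dots> = (\<Sum>a\<in>A. d a * cnj (d a) * of_real K)"
    using assms(1) by (intro sum.cong refl) simp
  also have "\<dots> = complex_of_real (K * (\<Sum>a\<in>A. (cmod (d a))\<^sup>2))"
    by (simp add: complex_norm_square sum_distrib_left mult_ac del: of_real_power)
  finally show ?thesis
    by (simp only: of_real_eq_iff)
qed

definition root_of_unity :: "nat \<Rightarrow> nat \<Rightarrow> complex" where
  "root_of_unity N t = exp (2 * of_real pi * \<i> * of_nat t / of_nat N)"

lemma norm_root_of_unity [simp]: "cmod (root_of_unity N t) = 1"
  by (simp add: root_of_unity_def norm_exp_eq_Re Re_divide_of_nat)

text \<open>
The matrix of the discrete Fourier transform is symmetric; this turns sums over sample points into
geometric series, and lets the transform be applied to either index.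
\<close>

lemma root_of_unity_power_commute: "root_of_unity N t ^ a = root_of_unity N a ^ t"
  by (simp add: root_of_unity_def flip: exp_of_nat_mult) (simp add: mult_ac)

lemma root_of_unity_power_self: "N > 0 \<Longrightarrow> root_of_unity N t ^ N = 1"
  unfolding root_of_unity_def by (metis complex_root_unity neq0_conv)

lemma root_of_unity_inj:
  assumes "a < N" "b < N" "root_of_unity N a = root_of_unity N b"
  shows "a = b"
proof -
  have "a mod N = b mod N"
    using assms complex_root_unity_eq[of N a b] unfolding root_of_unity_def by force
  thus ?thesis using assms by simp
qed

lemma root_of_unity_orthogonal:
  assumes "a < N" "b < N"
  shows "(\<Sum>t<N. root_of_unity N t ^ a * cnj (root_of_unity N t ^ b))
    = (if a = b then of_real (real N) else 0)"
proof -
  define x where "x = root_of_unity N a * cnj (root_of_unity N b)"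
  have unit: "root_of_unity N c * cnj (root_of_unity N c) = 1" for c
    by (metis complex_norm_square norm_root_of_unity of_real_1 one_power2)
  have "(\<Sum>t<N. root_of_unity N t ^ a * cnj (root_of_unity N t ^ b)) = (\<Sum>t<N. x ^ t)"
    by (intro sum.cong refl, subst (1 2) root_of_unity_power_commute)
      (simp add: x_def power_mult_distrib)
  also have "\<dots> = (if a = b then of_real (real N) else 0)"
  proof (cases "a = b")
    case True
    thus ?thesis by (simp add: x_def unit)
  next
    case False
    have "x * root_of_unity N b = root_of_unity N a"
      using unit[of b] by (simp add: x_def mult_ac)
    hence "x \<noteq> 1" using root_of_unity_inj[OF assms] False by auto
    moreover have "x ^ N = 1"
      using assms by (simp add: x_def power_mult_distrib root_of_unity_power_self flip: complex_cnj_power)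
    ultimately show ?thesis using False by (simp add: sum_gp_strict)
  qed
  finally show ?thesis .
qed

text \<open>
Monomials whose exponents are all below \<open>N\<close> are orthogonal on the grid of \<open>N\<close>-th roots of unity
because the sum over the grid factors into one-variable sums.
\<close>

lemma torus_grid_orthogonal:
  assumes \<alpha>: "\<alpha> \<in> {..<n} \<rightarrow>\<^sub>E {..<N}" and \<beta>: "\<beta> \<in> {..<n} \<rightarrow>\<^sub>E {..<N}"
  shows "(\<Sum>t \<in> {..<n} \<rightarrow>\<^sub>E {..<N}. monomial n (\<lambda>j. root_of_unity N (t j)) \<alpha> *
            cnj (monomial n (\<lambda>j. root_of_unity N (t j)) \<beta>))
    = (if \<alpha> = \<beta> then of_real (real N ^ n) else 0)"
proof -
  have "(\<Sum>t \<in> {..<n} \<rightarrow>\<^sub>E {..<N}. monomial n (\<lambda>j. root_of_unity N (t j)) \<alpha> *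
            cnj (monomial n (\<lambda>j. root_of_unity N (t j)) \<beta>))
      = (\<Sum>t \<in> {..<n} \<rightarrow>\<^sub>E {..<N}. \<Prod>j<n. root_of_unity N (t j) ^ \<alpha> j * cnj (root_of_unity N (t j) ^ \<beta> j))"
    by (simp add: monomial_def prod.distrib)
  also have "\<dots> = (\<Prod>j<n. \<Sum>t<N. root_of_unity N t ^ \<alpha> j * cnj (root_of_unity N t ^ \<beta> j))"
    by (rule prod_sum_PiE[symmetric]) auto
  also have "\<dots> = (\<Prod>j<n. if \<alpha> j = \<beta> j then of_real (real N) else 0)"
    using assms by (intro prod.cong refl root_of_unity_orthogonal) (auto simp: PiE_iff)
  also have "\<dots> = (if \<alpha> = \<beta> then of_real (real N ^ n) else 0)"
  proof (cases "\<alpha> = \<beta>")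
    case False
    then obtain j where "j < n" "\<alpha> j \<noteq> \<beta> j"
      using PiE_ext[OF \<alpha> \<beta>] by auto
    thus ?thesis using False by (auto intro!: prod_zero)
  qed simp
  finally show ?thesis .
qed

lemma parseval_circle:
  assumes "D < N"
  shows "(\<Sum>t<N. (cmod (\<Sum>j\<le>D. b j * root_of_unity N t ^ j))\<^sup>2) = real N * (\<Sum>j\<le>D. (cmod (b j))\<^sup>2)"
proof (rule parseval_orthogonal)
  fix a a' assume "a \<in> {..D}" "a' \<in> {..D}"
  thus "(\<Sum>t<N. root_of_unity N t ^ a * cnj (root_of_unity N t ^ a'))
      = (if a = a' then of_real (real N) else 0)"
    using assms by (intro root_of_unity_orthogonal) auto
qed simp

section \<open>Coefficients of bounded polynomials in one variable\<close>

text \<open>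
This is F. Wiener's inequality, with the scale \<open>M\<close> kept free so that it can be applied to
truncations that exceed 1 slightly. Multiplication by a function bounded by \<open>M\<close> does not increase
the mean square by more than the factor \<open>M\<^sup>2\<close>. For the multiplier \<open>1 + v \<zeta>\<^sup>k\<close> this bounds
\<open>|b\<^sub>0|\<^sup>2 + |b\<^sub>k + v b\<^sub>0|\<^sup>2\<close>, the contribution of degrees 0 and \<open>k\<close> of the product, by
\<open>M\<^sup>2 (1 + |v|\<^sup>2)\<close>, and the best choice of \<open>v\<close> gives the inequality.
\<close>

lemma wiener_coefficient_bound:
  fixes b :: "nat \<Rightarrow> complex"
  assumes "0 < k" "k \<le> D" "M > 0" "cmod (b 0) < M"
    and bound: "\<And>\<zeta>. cmod \<zeta> = 1 \<Longrightarrow> cmod (\<Sum>j\<le>D. b j * \<zeta> ^ j) \<le> M"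
  shows "cmod (b k) \<le> M - (cmod (b 0))\<^sup>2 / M"
proof -
  define N where "N = Suc (D + k)"
  define A where "A = (cmod (b 0))\<^sup>2"
  have A: "A < M\<^sup>2" using assms by (simp add: A_def power_strict_mono)
  \<comment> \<open>Among multiples \<open>v\<close> of \<open>cnj (b 0) * b k\<close>, this factor optimises the resulting inequality.\<close>
  define s where "s = 1 / (M\<^sup>2 - A)"
  define v where "v = of_real s * cnj (b 0) * b k"
  \<comment> \<open>Coefficients of the product and of the multiplier; \<open>N\<close> exceeds the degree of the product.\<close>
  define e where "e j = (if j \<le> D then b j else 0) + (if k \<le> j then v * b (j - k) else 0)" for j
  define h where "h j = (if j = 0 then 1 else 0) + (if j = k then v else 0)" for j
  have h: "(\<Sum>j\<le>D. h j * \<zeta> ^ j) = 1 + v * \<zeta> ^ k" for \<zeta>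
    using assms by (simp add: h_def ring_distribs sum.distrib if_distrib[of "\<lambda>x. x * _"] sum.delta cong: if_cong)
  have e: "(\<Sum>j\<le>D+k. e j * \<zeta> ^ j) = (\<Sum>j\<le>D. b j * \<zeta> ^ j) * (1 + v * \<zeta> ^ k)" for \<zeta>
  proof -
    have "(\<Sum>j\<le>D+k. (if j \<le> D then b j else 0) * \<zeta> ^ j) = (\<Sum>j\<le>D. b j * \<zeta> ^ j)"
      by (rule sum.mono_neutral_cong_right) auto
    moreover have "(\<Sum>j\<le>D+k. (if k \<le> j then v * b (j - k) else 0) * \<zeta> ^ j)
        = (\<Sum>j\<in>{k..D+k}. v * b (j - k) * \<zeta> ^ j)"
      by (rule sum.mono_neutral_cong_right) auto
    moreover have "\<dots> = (\<Sum>j\<le>D. v * \<zeta> ^ k * (b j * \<zeta> ^ j))"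
      by (rule sum.reindex_bij_witness[of _ "\<lambda>j. j + k" "\<lambda>j. j - k"]) (auto simp: power_add[symmetric])
    ultimately show ?thesis
      by (simp add: e_def ring_distribs sum.distrib sum_distrib_left mult_ac)
  qed
  have "(cmod (e 0))\<^sup>2 + (cmod (e k))\<^sup>2 = (\<Sum>j\<in>{0,k}. (cmod (e j))\<^sup>2)"
    using assms by simp
  also have "\<dots> \<le> (\<Sum>j\<le>D+k. (cmod (e j))\<^sup>2)"
    by (rule sum_mono2) auto
  finally have "real N * ((cmod (e 0))\<^sup>2 + (cmod (e k))\<^sup>2) \<le> real N * (\<Sum>j\<le>D+k. (cmod (e j))\<^sup>2)"
    by (intro mult_left_mono) auto
  also have "\<dots> = (\<Sum>t<N. (cmod (\<Sum>j\<le>D+k. e j * root_of_unity N t ^ j))\<^sup>2)"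
    by (subst parseval_circle) (auto simp: N_def)
  also have "\<dots> \<le> (\<Sum>t<N. M\<^sup>2 * (cmod (\<Sum>j\<le>D. h j * root_of_unity N t ^ j))\<^sup>2)"
    unfolding e h norm_mult power_mult_distrib
    by (intro sum_mono mult_right_mono power_mono bound) auto
  also have "\<dots> = M\<^sup>2 * (real N * (\<Sum>j\<le>D. (cmod (h j))\<^sup>2))"
    unfolding sum_distrib_left[symmetric] by (subst parseval_circle) (auto simp: N_def)
  also have "(\<Sum>j\<le>D. (cmod (h j))\<^sup>2) = (\<Sum>j\<in>{0,k}. (cmod (h j))\<^sup>2)"
    using assms by (intro sum.mono_neutral_right) (auto simp: h_def)
  also have "\<dots> = 1 + (cmod v)\<^sup>2"
    using assms by (simp add: h_def)
  finally have "real N * ((cmod (e 0))\<^sup>2 + (cmod (e k))\<^sup>2) \<le> real N * (M\<^sup>2 * (1 + (cmod v)\<^sup>2))"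
    by (simp add: mult_ac)
  hence ineq: "(cmod (e 0))\<^sup>2 + (cmod (e k))\<^sup>2 \<le> M\<^sup>2 * (1 + (cmod v)\<^sup>2)"
    by (subst (asm) mult_le_cancel_left_pos) (auto simp: N_def)
  have e0: "e 0 = b 0" using assms by (simp add: e_def)
  have "e k = b k * of_real (1 + s * A)"
    using assms by (simp add: e_def v_def A_def algebra_simps complex_norm_square del: of_real_power)
  hence ek: "(cmod (e k))\<^sup>2 = (cmod (b k))\<^sup>2 * (1 + s * A)\<^sup>2"
    by (metis norm_mult norm_of_real power2_abs power_mult_distrib)
  have v: "(cmod v)\<^sup>2 = s\<^sup>2 * A * (cmod (b k))\<^sup>2"
    by (simp add: v_def norm_mult power_mult_distrib A_def)
  have s: "s * (M\<^sup>2 - A) = 1" using A by (simp add: s_def)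
  have "(cmod (b k))\<^sup>2 * ((1 + s * A)\<^sup>2 - M\<^sup>2 * s\<^sup>2 * A) \<le> M\<^sup>2 - A"
    using ineq unfolding e0 ek v A_def[symmetric] by (simp add: algebra_simps)
  also have "(1 + s * A)\<^sup>2 - M\<^sup>2 * s\<^sup>2 * A = 1 + s * A * (2 - s * (M\<^sup>2 - A))"
    by (simp add: power2_eq_square algebra_simps)
  also have "\<dots> = s * M\<^sup>2"
    using s by (simp add: algebra_simps)
  finally have "(cmod (b k))\<^sup>2 * M\<^sup>2 \<le> (M\<^sup>2 - A)\<^sup>2"
    using A by (simp add: s_def field_simps power2_eq_square)
  hence "(cmod (b k) * M)\<^sup>2 \<le> (M\<^sup>2 - A)\<^sup>2"
    by (simp add: power_mult_distrib)
  hence "cmod (b k) * M \<le> M\<^sup>2 - A"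
    by (rule power2_le_imp_le) (use A in auto)
  thus ?thesis using assms by (simp add: A_def field_simps power2_eq_square)
qed

section \<open>Multi-indices of a given degree\<close>

definition multi_indices_of_degree :: "nat \<Rightarrow> nat \<Rightarrow> (nat \<Rightarrow> nat) set" where
  "multi_indices_of_degree n k = {\<alpha> \<in> multi_indices n. (\<Sum>j<n. \<alpha> j) = k}"

lemma multi_indices_of_degree_subset_PiE:
  "multi_indices_of_degree n k \<subseteq> {..<n} \<rightarrow>\<^sub>E {..<Suc k}"
proof
  fix \<alpha> assume \<alpha>: "\<alpha> \<in> multi_indices_of_degree n k"
  have "\<alpha> j \<le> k" if "j < n" for j
    using \<alpha> that member_le_sum[of j "{..<n}" \<alpha>] by (auto simp: multi_indices_of_degree_def)
  thus "\<alpha> \<in> {..<n} \<rightarrow>\<^sub>E {..<Suc k}"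
    using \<alpha> by (auto simp: multi_indices_of_degree_def multi_indices_def PiE_iff less_Suc_eq_le)
qed

lemma finite_multi_indices_of_degree [simp]: "finite (multi_indices_of_degree n k)"
  by (rule finite_subset[OF multi_indices_of_degree_subset_PiE]) (auto intro: finite_PiE)

abbreviation zero_index :: "nat \<Rightarrow> nat \<Rightarrow> nat" where
  "zero_index n \<equiv> restrict (\<lambda>_. 0) {..<n}"

lemma multi_indices_of_degree_0: "multi_indices_of_degree n 0 = {zero_index n}"
  by (auto simp: multi_indices_of_degree_def multi_indices_def PiE_iff extensional_def fun_eq_iff)

text \<open>
A multi-index of positive degree has a positive entry that can be lowered. Counting through this
surjection gives the bound \<open>n\<^sup>k\<close> for the number of multi-indices of degree \<open>k\<close>.
\<close>

lemma multi_indices_of_degree_Suc: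
  "multi_indices_of_degree n (Suc k)
    \<subseteq> (\<lambda>(j, \<alpha>). \<alpha>(j := Suc (\<alpha> j))) ` ({..<n} \<times> multi_indices_of_degree n k)"
proof
  fix \<alpha> assume \<alpha>: "\<alpha> \<in> multi_indices_of_degree n (Suc k)"
  hence "\<exists>j<n. \<alpha> j \<noteq> 0"
    by (auto simp: multi_indices_of_degree_def intro: ccontr)
  then obtain j where j: "j < n" "\<alpha> j \<noteq> 0" by blast
  define \<beta> where "\<beta> = \<alpha>(j := \<alpha> j - 1)"
  have "(\<Sum>i<n. \<alpha> i) = \<alpha> j + (\<Sum>i\<in>{..<n}-{j}. \<alpha> i)"
    using j by (subst sum.remove[of _ j]) auto
  moreover have "(\<Sum>i<n. \<beta> i) = \<beta> j + (\<Sum>i\<in>{..<n}-{j}. \<beta> i)"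
    using j by (subst sum.remove[of _ j]) auto
  moreover have "(\<Sum>i\<in>{..<n}-{j}. \<beta> i) = (\<Sum>i\<in>{..<n}-{j}. \<alpha> i)"
    by (intro sum.cong) (auto simp: \<beta>_def)
  ultimately have "\<beta> \<in> multi_indices_of_degree n k"
    using \<alpha> j by (auto simp: multi_indices_of_degree_def multi_indices_def PiE_iff extensional_def \<beta>_def)
  moreover have "\<alpha> = (\<lambda>(j, \<alpha>). \<alpha>(j := Suc (\<alpha> j))) (j, \<beta>)"
    using j by (auto simp: \<beta>_def)
  ultimately show "\<alpha> \<in> (\<lambda>(j, \<alpha>). \<alpha>(j := Suc (\<alpha> j))) ` ({..<n} \<times> multi_indices_of_degree n k)"
    using j by blast
qed

lemma card_multi_indices_of_degree_Suc_le:
  "card (multi_indices_of_degree n (Suc k)) \<le> n * card (multi_indices_of_degree n k)"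
proof -
  have "card (multi_indices_of_degree n (Suc k)) \<le> card ({..<n} \<times> multi_indices_of_degree n k)"
    by (rule surj_card_le[OF _ multi_indices_of_degree_Suc]) auto
  thus ?thesis by (simp add: card_cartesian_product)
qed

lemma card_multi_indices_of_degree_1_le: "card (multi_indices_of_degree n 1) \<le> n"
  using card_multi_indices_of_degree_Suc_le[of n 0] by (simp add: multi_indices_of_degree_0)

text \<open>
In degree two the order of the two raised entries is irrelevant, so that only pairs
\<open>(max i j, min i j)\<close> have to be counted. The gain over \<open>n\<^sup>2\<close> is what makes the lower bound for the
Bohr radius strict.
\<close>

lemma card_multi_indices_of_degree_2_le: "2 * card (multi_indices_of_degree n 2) \<le> n * (n + 1)"
proof -
  define P where "P = (SIGMA j:{..<n}. {..j})"
  \<comment> \<open>The sum of the \<open>i\<close>-th and the \<open>j\<close>-th unit vector; entry \<open>j\<close> is written last and is 2 if \<open>i = j\<close>.\<close>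
  define g where "g = (\<lambda>(j::nat, i::nat). (zero_index n)(i := Suc 0, j := (if i = j then 2 else 1::nat)))"
  have "multi_indices_of_degree n 2 \<subseteq> g ` P"
  proof
    fix \<alpha> assume "\<alpha> \<in> multi_indices_of_degree n 2"
    then obtain i \<beta> where i: "i < n" "\<beta> \<in> multi_indices_of_degree n 1" "\<alpha> = \<beta>(i := Suc (\<beta> i))"
      using multi_indices_of_degree_Suc[of n 1] by (auto simp: numeral_2_eq_2)
    then obtain j where j: "j < n" "\<beta> = (zero_index n)(j := Suc 0)"
      using multi_indices_of_degree_Suc[of n 0] by (auto simp: multi_indices_of_degree_0)
    have "\<alpha> = g (max i j, min i j)"
      using i(1,3) j by (auto simp: g_def fun_eq_iff max_def min_def)
    moreover have "(max i j, min i j) \<in> P"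
      using i j by (auto simp: P_def)
    ultimately show "\<alpha> \<in> g ` P" by blast
  qed
  hence "card (multi_indices_of_degree n 2) \<le> card P"
    by (intro surj_card_le) (auto simp: P_def)
  moreover have "card P = (\<Sum>j<n. Suc j)"
    by (simp add: P_def)
  moreover have "2 * (\<Sum>j<n. Suc j) = n * (n + 1)"
    by (induction n) auto
  ultimately show ?thesis by linarith
qed

lemma card_multi_indices_of_degree_ge_2_le:
  assumes "n \<ge> 2" "k \<ge> 2"
  shows "4 * card (multi_indices_of_degree n k) \<le> 3 * n ^ k"
  using assms(2)
proof (induction k rule: dec_induct)
  case base
  have "2 * (n * (n + 1)) \<le> 3 * n\<^sup>2"
    using assms(1) by (simp add: power2_eq_square algebra_simps)
  thus ?case using card_multi_indices_of_degree_2_le[of n] by linarith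
next
  case (step k)
  have "4 * card (multi_indices_of_degree n (Suc k)) \<le> n * (4 * card (multi_indices_of_degree n k))"
    using card_multi_indices_of_degree_Suc_le[of n k] by simp
  also have "\<dots> \<le> n * (3 * n ^ k)" using step by (intro mult_left_mono) auto
  finally show ?case by (simp add: mult_ac)
qed

lemma multi_index_finite_subset_degree:
  assumes "finite F" "F \<subseteq> multi_indices n"
  obtains D where "k \<le> D" "F \<subseteq> (\<Union>j\<le>D. multi_indices_of_degree n j)"
proof -
  define D where "D = Max (insert k ((\<lambda>\<alpha>. \<Sum>j<n. \<alpha> j) ` F))"
  have "(\<Sum>j<n. \<alpha> j) \<le> D" if "\<alpha> \<in> F" for \<alpha>
    unfolding D_def using assms(1) that by (intro Max_ge) auto
  hence "F \<subseteq> (\<Union>j\<le>D. multi_indices_of_degree n j)"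
    using assms(2) by (force simp: multi_indices_of_degree_def)
  moreover have "k \<le> D" unfolding D_def using assms(1) by (intro Max_ge) auto
  ultimately show ?thesis using that by blast
qed

lemma sum_up_to_degree:
  "(\<Sum>\<alpha>\<in>(\<Union>j\<le>D. multi_indices_of_degree n j). f \<alpha>) = (\<Sum>j\<le>D. \<Sum>\<alpha>\<in>multi_indices_of_degree n j. f \<alpha>)"
  by (rule sum.UNION_disjoint) (simp_all, auto simp: multi_indices_of_degree_def)

section \<open>Homogeneous parts of a bounded power series\<close>

lemma monomial_scale: "monomial n (\<lambda>j. s * z j) \<alpha> = s ^ (\<Sum>j<n. \<alpha> j) * monomial n z \<alpha>"
  by (simp add: monomial_def power_mult_distrib prod.distrib power_sum)

lemma norm_monomial: "cmod (monomial n z \<alpha>) = (\<Prod>j<n. cmod (z j) ^ \<alpha> j)"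
  by (simp add: monomial_def prod_norm[symmetric] norm_power)

lemma norm_monomial_le:
  assumes "\<And>j. j < n \<Longrightarrow> cmod (z j) \<le> r"
  shows "cmod (monomial n z \<alpha>) \<le> r ^ (\<Sum>j<n. \<alpha> j)"
  unfolding norm_monomial power_sum using assms by (intro prod_mono) (auto intro: power_mono)

text \<open>
The hypothesis that \<open>bohr_property\<close> puts on a power series.
\<close>

definition power_series_below_1 :: "nat \<Rightarrow> ((nat \<Rightarrow> nat) \<Rightarrow> complex) \<Rightarrow> bool" where
  "power_series_below_1 n c \<longleftrightarrow> (\<forall>z \<in> polydisc n 1.
     (\<lambda>\<alpha>. c \<alpha> * monomial n z \<alpha>) summable_on multi_indices n \<and>
     cmod (\<Sum>\<^sub>\<infinity>\<alpha>\<in>multi_indices n. c \<alpha> * monomial n z \<alpha>) < 1)"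

definition homogeneous_part ::
  "nat \<Rightarrow> ((nat \<Rightarrow> nat) \<Rightarrow> complex) \<Rightarrow> nat \<Rightarrow> (nat \<Rightarrow> complex) \<Rightarrow> complex" where
  "homogeneous_part n c k z = (\<Sum>\<alpha>\<in>multi_indices_of_degree n k. c \<alpha> * monomial n z \<alpha>)"

lemma homogeneous_part_0: "homogeneous_part n c 0 z = c (zero_index n)"
  by (simp add: homogeneous_part_def multi_indices_of_degree_0 monomial_def)

lemma homogeneous_part_scale: "homogeneous_part n c k (\<lambda>j. s * z j) = s ^ k * homogeneous_part n c k z"
  unfolding homogeneous_part_def sum_distrib_left monomial_scale
  by (intro sum.cong) (auto simp: multi_indices_of_degree_def)

lemma power_series_below_1_constant_term:
  assumes "power_series_below_1 n c"
  shows "cmod (c (zero_index n)) < 1"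
proof -
  let ?o = "zero_index n"
  have o: "?o \<in> multi_indices n"
    by (auto simp: multi_indices_def)
  have "monomial n (\<lambda>_. 0) \<alpha> = 0" if "\<alpha> \<in> multi_indices n" "\<alpha> \<noteq> ?o" for \<alpha>
  proof -
    have "\<exists>j<n. \<alpha> j \<noteq> 0"
    proof (rule ccontr)
      assume "\<not> (\<exists>j<n. \<alpha> j \<noteq> 0)"
      hence "\<alpha> = ?o"
        using that(1) by (auto simp: multi_indices_def PiE_iff extensional_def fun_eq_iff)
      with that(2) show False by contradiction
    qed
    thus ?thesis by (auto simp: monomial_def intro!: prod_zero)
  qed
  hence "(\<Sum>\<^sub>\<infinity>\<alpha>\<in>multi_indices n. c \<alpha> * monomial n (\<lambda>_. 0) \<alpha>)
      = (\<Sum>\<^sub>\<infinity>\<alpha>\<in>{?o}. c \<alpha> * monomial n (\<lambda>_. 0) \<alpha>)"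
    using o by (intro infsum_cong_neutral) auto
  also have "\<dots> = c ?o" by (simp add: monomial_def)
  finally have "(\<Sum>\<^sub>\<infinity>\<alpha>\<in>multi_indices n. c \<alpha> * monomial n (\<lambda>_. 0) \<alpha>) = c ?o" .
  moreover have "(\<lambda>_. 0) \<in> polydisc n 1" by (simp add: polydisc_def)
  ultimately show ?thesis
    using assms unfolding power_series_below_1_def by metis
qed

text \<open>
On the closed polydisc of radius \<open>\<rho> < 1\<close> the series converges absolutely and uniformly, so its
partial sums over all degrees up to a large \<open>D\<close> are bounded by \<open>1 + \<epsilon>\<close> there. This reduces
statements on power series to polynomials. The radius is absorbed into the coefficients, so that
the points \<open>z\<close> range over the unit torus.
\<close>

lemma truncation_bound:
  assumes c: "power_series_below_1 n c" and "0 \<le> \<rho>" "\<rho> < 1" "\<epsilon> > 0"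
  obtains D where "k \<le> D"
    "\<And>z. (\<And>j. j < n \<Longrightarrow> cmod (z j) = 1) \<Longrightarrow> cmod (\<Sum>j\<le>D. of_real \<rho> ^ j * homogeneous_part n c j z) \<le> 1 + \<epsilon>"
proof -
  let ?I = "multi_indices n"
  \<comment> \<open>On the torus the absolute values of the terms do not depend on \<open>z\<close>; this is why the tail is uniformly small.\<close>
  define g where "g \<alpha> = cmod (c \<alpha>) * \<rho> ^ (\<Sum>j<n. \<alpha> j)" for \<alpha>
  have norm_term: "cmod (c \<alpha> * monomial n (\<lambda>j. of_real \<rho> * z j) \<alpha>) = g \<alpha>"
    if "\<And>j. j < n \<Longrightarrow> cmod (z j) = 1" for z \<alpha>
    using that \<open>0 \<le> \<rho>\<close> by (simp add: g_def norm_mult monomial_scale norm_power norm_monomial)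
  have in_disc: "(\<lambda>j. of_real \<rho> * z j) \<in> polydisc n 1" if "\<And>j. j < n \<Longrightarrow> cmod (z j) = 1" for z
    using that assms by (simp add: polydisc_def norm_mult)
  have g: "g summable_on ?I"
  proof -
    have "(\<lambda>\<alpha>. cmod (c \<alpha> * monomial n (\<lambda>j. of_real \<rho> * 1) \<alpha>)) summable_on ?I"
      using c in_disc[of "\<lambda>_. 1"] unfolding power_series_below_1_def summable_on_iff_abs_summable_on_complex by simp
    thus ?thesis by (simp only: norm_term[of "\<lambda>_. 1", simplified] mult_1_right)
  qed
  then obtain F where F: "finite F" "F \<subseteq> ?I" "dist (sum g F) (infsum g ?I) \<le> \<epsilon>"
    using infsum_finite_approximation[OF g \<open>\<epsilon> > 0\<close>] by blast
  obtain D where D: "k \<le> D" "F \<subseteq> (\<Union>j\<le>D. multi_indices_of_degree n j)"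
    using multi_index_finite_subset_degree[OF F(1,2)] .
  let ?A = "\<Union>j\<le>D. multi_indices_of_degree n j"
  have A: "finite ?A" "?A \<subseteq> ?I" by (simp, auto simp: multi_indices_of_degree_def)
  have "sum g F \<le> sum g ?A"
    using D A \<open>0 \<le> \<rho>\<close> by (intro sum_mono2) (auto simp: g_def)
  hence tail: "infsum g (?I - ?A) \<le> \<epsilon>"
    using F(3) infsum_Diff[OF g summable_on_finite[OF A(1)] A(2)] by (auto simp: dist_real_def A)
  show ?thesis
  proof (rule that[OF D(1)])
    fix z :: "nat \<Rightarrow> complex" assume z: "\<And>j. j < n \<Longrightarrow> cmod (z j) = 1"
    define t where "t \<alpha> = c \<alpha> * monomial n (\<lambda>j. of_real \<rho> * z j) \<alpha>" for \<alpha>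
    have t: "t summable_on ?I" "cmod (infsum t ?I) < 1"
      using c in_disc[of z] z unfolding power_series_below_1_def t_def by auto
    have nt: "cmod (t \<alpha>) = g \<alpha>" for \<alpha> using norm_term z by (simp add: t_def)
    have "(\<Sum>j\<le>D. of_real \<rho> ^ j * homogeneous_part n c j z)
        = (\<Sum>j\<le>D. homogeneous_part n c j (\<lambda>i. of_real \<rho> * z i))"
      by (simp only: homogeneous_part_scale)
    also have "\<dots> = sum t ?A"
      unfolding sum_up_to_degree homogeneous_part_def t_def ..
    also have "\<dots> = infsum t ?I - infsum t (?I - ?A)"
      using infsum_Diff[OF t(1) summable_on_finite[OF A(1)] A(2)] A(1) by simp
    finally have eq: "(\<Sum>j\<le>D. of_real \<rho> ^ j * homogeneous_part n c j z) = infsum t ?I - infsum t (?I - ?A)" .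
    have "cmod (infsum t (?I - ?A)) \<le> (\<Sum>\<^sub>\<infinity>\<alpha>\<in>?I - ?A. cmod (t \<alpha>))"
      unfolding nt by (rule norm_infsum_bound[of t, unfolded nt], rule summable_on_subset_banach[OF g]) auto
    hence "cmod (infsum t (?I - ?A)) \<le> \<epsilon>" using tail by (simp add: nt)
    thus "cmod (\<Sum>j\<le>D. of_real \<rho> ^ j * homogeneous_part n c j z) \<le> 1 + \<epsilon>"
      unfolding eq using t(2) norm_triangle_ineq4[of "infsum t ?I" "infsum t (?I - ?A)"] by linarith
  qed
qed

text \<open>
For a fixed \<open>z\<close> on the torus, the slice \<open>\<zeta> \<mapsto> f(\<zeta> z)\<close> is a bounded function of one variable whose
\<open>k\<close>-th coefficient is the homogeneous part of degree \<open>k\<close> at \<open>z\<close>, so Wiener's inequality applies.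
The slice is truncated at radius \<open>1 - \<epsilon>\<close> with error \<open>\<epsilon>\<close>, and then \<open>\<epsilon>\<close> tends to 0.
\<close>

lemma homogeneous_part_bound:
  assumes c: "power_series_below_1 n c" and k: "k > 0" and z: "\<And>j. j < n \<Longrightarrow> cmod (z j) = 1"
  shows "cmod (homogeneous_part n c k z) \<le> 1 - (cmod (c (zero_index n)))\<^sup>2"
proof -
  define a where "a = cmod (c (zero_index n))"
  have a: "a < 1" using power_series_below_1_constant_term[OF c] by (simp add: a_def)
  have *: "(1 - \<epsilon>) ^ k * cmod (homogeneous_part n c k z) \<le> (1 + \<epsilon>) - a\<^sup>2 / (1 + \<epsilon>)"
    if \<epsilon>: "0 < \<epsilon>" "\<epsilon> < 1" for \<epsilon> :: real
  proof -
    define b where "b j = of_real (1 - \<epsilon>) ^ j * homogeneous_part n c j z" for j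
    obtain D where D: "k \<le> D" "\<And>z. (\<And>j. j < n \<Longrightarrow> cmod (z j) = 1) \<Longrightarrow>
        cmod (\<Sum>j\<le>D. of_real (1 - \<epsilon>) ^ j * homogeneous_part n c j z) \<le> 1 + \<epsilon>"
      using truncation_bound[OF c, of "1 - \<epsilon>" \<epsilon> k] \<epsilon> by auto
    have "cmod (\<Sum>j\<le>D. b j * \<zeta> ^ j) \<le> 1 + \<epsilon>" if "cmod \<zeta> = 1" for \<zeta>
    proof -
      have "(\<Sum>j\<le>D. b j * \<zeta> ^ j)
          = (\<Sum>j\<le>D. of_real (1 - \<epsilon>) ^ j * homogeneous_part n c j (\<lambda>i. \<zeta> * z i))"
        by (simp add: b_def homogeneous_part_scale mult_ac)
      thus ?thesis using D(2)[of "\<lambda>i. \<zeta> * z i"] z that by (simp add: norm_mult)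
    qed
    moreover have b0: "cmod (b 0) = a" by (simp add: b_def homogeneous_part_0 a_def)
    ultimately have "cmod (b k) \<le> (1 + \<epsilon>) - a\<^sup>2 / (1 + \<epsilon>)"
      using wiener_coefficient_bound[of k D "1 + \<epsilon>" b] k D(1) a \<epsilon> by auto
    moreover have "cmod (b k) = (1 - \<epsilon>) ^ k * cmod (homogeneous_part n c k z)"
      unfolding b_def norm_mult norm_power norm_of_real using \<epsilon> by simp
    ultimately show ?thesis by simp
  qed
  have "((\<lambda>\<epsilon>::real. (1 - \<epsilon>) ^ k * cmod (homogeneous_part n c k z))
      \<longlongrightarrow> (1 - 0) ^ k * cmod (homogeneous_part n c k z)) (at_right 0)"
    by (intro tendsto_intros)
  moreover have "((\<lambda>\<epsilon>::real. (1 + \<epsilon>) - a\<^sup>2 / (1 + \<epsilon>)) \<longlongrightarrow> (1 + 0) - a\<^sup>2 / (1 + 0)) (at_right 0)"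
    by (intro tendsto_intros) auto
  moreover have "eventually (\<lambda>\<epsilon>::real. (1 - \<epsilon>) ^ k * cmod (homogeneous_part n c k z)
      \<le> (1 + \<epsilon>) - a\<^sup>2 / (1 + \<epsilon>)) (at_right 0)"
    unfolding eventually_at_right_field using * by (auto intro!: exI[of _ 1])
  ultimately show ?thesis
    using tendsto_le[OF trivial_limit_at_right_real] unfolding a_def by force
qed

text \<open>
The pointwise bound on the torus becomes a bound on the mean square, that is, on the coefficients.
The grid of \<open>(k+1)\<close>-th roots of unity is fine enough for exponents up to \<open>k\<close>.
\<close>

lemma sum_square_homogeneous_coefficients:
  assumes c: "power_series_below_1 n c" and k: "k > 0"
  shows "(\<Sum>\<alpha>\<in>multi_indices_of_degree n k. (cmod (c \<alpha>))\<^sup>2)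
    \<le> (1 - (cmod (c (zero_index n)))\<^sup>2)\<^sup>2"
proof -
  define q where "q = 1 - (cmod (c (zero_index n)))\<^sup>2"
  let ?N = "Suc k"
  let ?T = "{..<n} \<rightarrow>\<^sub>E {..<?N}"
  let ?z = "\<lambda>t j. root_of_unity ?N (t j)"
  have "real ?N ^ n * (\<Sum>\<alpha>\<in>multi_indices_of_degree n k. (cmod (c \<alpha>))\<^sup>2)
      = (\<Sum>t\<in>?T. (cmod (homogeneous_part n c k (?z t)))\<^sup>2)"
    unfolding homogeneous_part_def
  proof (rule parseval_orthogonal[symmetric])
    fix \<alpha> \<beta> assume "\<alpha> \<in> multi_indices_of_degree n k" "\<beta> \<in> multi_indices_of_degree n k"
    thus "(\<Sum>t\<in>?T. monomial n (?z t) \<alpha> * cnj (monomial n (?z t) \<beta>))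
        = (if \<alpha> = \<beta> then of_real (real ?N ^ n) else 0)"
      by (intro torus_grid_orthogonal subsetD[OF multi_indices_of_degree_subset_PiE])
  qed simp
  also have "\<dots> \<le> (\<Sum>t\<in>?T. q\<^sup>2)"
    unfolding q_def by (intro sum_mono power_mono homogeneous_part_bound[OF c k]) auto
  also have "\<dots> = real ?N ^ n * q\<^sup>2"
    by (simp add: card_funcsetE)
  finally show ?thesis
    unfolding q_def by (subst (asm) mult_le_cancel_left_pos) auto
qed

text \<open>
The Cauchy--Schwarz inequality, applied to the coefficients of degree \<open>k\<close> and the constant \<open>r\<^sup>k\<close>,
brings in the square root of the number of multi-indices.
\<close>

lemma sum_norm_homogeneous_terms:
  assumes c: "power_series_below_1 n c" and k: "k > 0" and z: "z \<in> polydisc n r" and "r > 0"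
  shows "(\<Sum>\<alpha>\<in>multi_indices_of_degree n k. cmod (c \<alpha> * monomial n z \<alpha>))
    \<le> (1 - (cmod (c (zero_index n)))\<^sup>2) * (sqrt (card (multi_indices_of_degree n k)) * r ^ k)"
proof -
  let ?S = "multi_indices_of_degree n k"
  define q where "q = 1 - (cmod (c (zero_index n)))\<^sup>2"
  have q: "q \<ge> 0"
    using power_series_below_1_constant_term[OF c] by (simp add: q_def power_le_one)
  have "(\<Sum>\<alpha>\<in>?S. cmod (c \<alpha> * monomial n z \<alpha>)) \<le> (\<Sum>\<alpha>\<in>?S. \<bar>cmod (c \<alpha>)\<bar> * \<bar>r ^ k\<bar>)"
    unfolding norm_mult
  proof (intro sum_mono mult_mono)
    fix \<alpha> assume "\<alpha> \<in> ?S"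
    thus "cmod (monomial n z \<alpha>) \<le> \<bar>r ^ k\<bar>"
      using norm_monomial_le[of n z r \<alpha>] z \<open>r > 0\<close>
      by (force simp: multi_indices_of_degree_def polydisc_def)
  qed auto
  also have "\<dots> \<le> L2_set (\<lambda>\<alpha>. cmod (c \<alpha>)) ?S * L2_set (\<lambda>\<alpha>. r ^ k) ?S"
    by (rule L2_set_mult_ineq)
  also have "\<dots> \<le> q * (sqrt (card ?S) * r ^ k)"
  proof (intro mult_mono)
    show "L2_set (\<lambda>\<alpha>. cmod (c \<alpha>)) ?S \<le> q"
      unfolding L2_set_def using sum_square_homogeneous_coefficients[OF c k] q
      by (intro real_le_lsqrt) (auto simp: q_def intro: sum_nonneg)
    show "L2_set (\<lambda>\<alpha>. r ^ k) ?S \<le> sqrt (card ?S) * r ^ k"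
      using \<open>r > 0\<close> by (simp add: L2_set_def real_sqrt_mult)
  qed (use q \<open>r > 0\<close> in auto)
  finally show ?thesis by (simp add: q_def)
qed

section \<open>The lower bound\<close>

text \<open>
These are the factors that the Cauchy--Schwarz inequality produces in each degree, in terms of
\<open>x = r sqrt n\<close>. The constant \<open>7/8\<close> is a rational upper bound of \<open>sqrt (3/4)\<close>.
\<close>

lemma sqrt_card_times_power:
  assumes n: "n \<ge> 2" and x: "0 \<le> x" "x = sqrt (real n) * r"
  shows "sqrt (card (multi_indices_of_degree n (Suc 0))) * r \<le> x"
    and "k \<ge> 2 \<Longrightarrow> sqrt (card (multi_indices_of_degree n k)) * r ^ k \<le> 7/8 * x ^ k"
proof -
  have r: "r \<ge> 0" using n x by (simp add: zero_le_mult_iff)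
  show "sqrt (card (multi_indices_of_degree n (Suc 0))) * r \<le> x"
    unfolding x using r card_multi_indices_of_degree_1_le[of n] by (intro mult_right_mono) auto
  assume "k \<ge> 2"
  have "4 * real (card (multi_indices_of_degree n k)) \<le> 3 * real n ^ k"
    using card_multi_indices_of_degree_ge_2_le[OF n \<open>k \<ge> 2\<close>]
    by (metis (no_types, lifting) of_nat_le_iff of_nat_mult of_nat_numeral of_nat_power)
  hence "real (card (multi_indices_of_degree n k)) \<le> (7/8)\<^sup>2 * real n ^ k"
    using zero_le_power[of "real n" k] by (simp add: power2_eq_square)
  hence "sqrt (card (multi_indices_of_degree n k)) \<le> sqrt ((7/8)\<^sup>2 * real n ^ k)"
    by (rule real_sqrt_le_mono)
  also have "\<dots> = 7/8 * sqrt (real n) ^ k"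
    by (simp add: real_sqrt_mult real_sqrt_power)
  finally have "sqrt (card (multi_indices_of_degree n k)) * r ^ k \<le> 7/8 * sqrt (real n) ^ k * r ^ k"
    using r by (intro mult_right_mono) auto
  thus "sqrt (card (multi_indices_of_degree n k)) * r ^ k \<le> 7/8 * x ^ k"
    by (simp add: x power_mult_distrib)
qed

text \<open>
Writing \<open>a\<close> for the absolute value of the constant term and \<open>x = r sqrt n\<close>, the terms of degree \<open>k > 0\<close>
contribute at most \<open>(1 - a\<^sup>2) x\<^sup>k\<close>, with an extra factor \<open>7/8\<close> from degree two on. As long as these
bounds sum to at most \<open>(1 - a\<^sup>2) / 2\<close>, the total is at most \<open>1 - (1 - a)\<^sup>2 / 2 < 1\<close>. Without the extra
factor the largest admissible \<open>x\<close> is \<open>1/3\<close>; with it, \<open>x = 17/50 > 1/3\<close> is still small enough.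
\<close>

lemma bohr_property_lower:
  assumes n: "n \<ge> 2" and r: "r = 17 / (50 * sqrt (real n))"
  shows "bohr_property n r"
  unfolding bohr_property_def
proof (intro allI impI ballI)
  fix c z
  assume "\<forall>z\<in>polydisc n 1. (\<lambda>\<alpha>. c \<alpha> * monomial n z \<alpha>) summable_on multi_indices n \<and>
     cmod (\<Sum>\<^sub>\<infinity>\<alpha>\<in>multi_indices n. c \<alpha> * monomial n z \<alpha>) < 1" and z: "z \<in> polydisc n r"
  hence c: "power_series_below_1 n c" by (simp add: power_series_below_1_def)
  define a where "a = cmod (c (zero_index n))"
  have a: "0 \<le> a" "a < 1" using power_series_below_1_constant_term[OF c] by (auto simp: a_def)
  define q where "q = 1 - a\<^sup>2"
  have q: "q \<ge> 0" using a by (simp add: q_def power_le_one)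
  define x :: real where "x = 17/50"
  have x: "0 \<le> x" "x = sqrt (real n) * r" using n by (auto simp: x_def r)
  have "r > 0" using n by (simp add: r)
  define s where "s j = (\<Sum>\<alpha>\<in>multi_indices_of_degree n j. cmod (c \<alpha> * monomial n z \<alpha>))" for j
  have s0: "s 0 = a"
    by (simp add: s_def a_def multi_indices_of_degree_0 monomial_def)
  note s_le = sum_norm_homogeneous_terms[OF c _ z \<open>r > 0\<close>, folded a_def q_def s_def]
  have s1: "s 1 \<le> q * x"
    using s_le[of 1] mult_left_mono[OF sqrt_card_times_power(1)[OF n x] q] by simp
  have s2: "s k \<le> q * (7/8 * x ^ k)" if "k \<ge> 2" for k
    using s_le[of k] mult_left_mono[OF sqrt_card_times_power(2)[OF n x that] q] that by linarith
  have partial: "(\<Sum>j\<le>Suc D. s j) \<le> a + q * (x + 7/8 * (x\<^sup>2 - x ^ (D + 2)) / (1 - x))" for D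
  proof (induction D)
    case 0
    thus ?case using s0 s1 by (simp add: power2_eq_square)
  next
    case (Suc D)
    have "(\<Sum>j\<le>Suc (Suc D). s j)
        \<le> a + q * (x + 7/8 * (x\<^sup>2 - x ^ (D + 2)) / (1 - x)) + q * (7/8 * x ^ (D + 2))"
      using Suc s2[of "D + 2"] by simp
    also have "\<dots> = a + q * (x + 7/8 * (x\<^sup>2 - x ^ (Suc D + 2)) / (1 - x))"
      by (simp add: x_def field_simps)
    finally show ?case .
  qed
  have bound: "(\<Sum>\<alpha>\<in>F. cmod (c \<alpha> * monomial n z \<alpha>)) \<le> a + q * (1/2)"
    if F: "finite F" "F \<subseteq> multi_indices n" for F
  proof -
    obtain D where D: "1 \<le> D" "F \<subseteq> (\<Union>j\<le>D. multi_indices_of_degree n j)"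
      using multi_index_finite_subset_degree[OF F] .
    have "(\<Sum>\<alpha>\<in>F. cmod (c \<alpha> * monomial n z \<alpha>)) \<le> (\<Sum>j\<le>D. s j)"
      unfolding s_def sum_up_to_degree[symmetric] using D by (intro sum_mono2) auto
    also have "\<dots> \<le> a + q * (x + 7/8 * (x\<^sup>2 - x ^ (D - 1 + 2)) / (1 - x))"
      using partial[of "D - 1"] D by simp
    also have "\<dots> \<le> a + q * (1/2)"
    proof (intro add_left_mono mult_left_mono[OF _ q])
      have "7/8 * (x\<^sup>2 - x ^ (D - 1 + 2)) / (1 - x) \<le> 7/8 * x\<^sup>2 / (1 - x)"
        by (intro divide_right_mono) (auto simp: x_def)
      also have "\<dots> \<le> 1/2 - x" by (simp add: x_def power2_eq_square)
      finally show "x + 7/8 * (x\<^sup>2 - x ^ (D - 1 + 2)) / (1 - x) \<le> 1/2"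
        by (simp only: le_diff_eq add.commute)
    qed
    finally show ?thesis .
  qed
  have summable: "(\<lambda>\<alpha>. cmod (c \<alpha> * monomial n z \<alpha>)) summable_on multi_indices n"
    by (rule nonneg_bdd_above_summable_on) (auto intro!: bdd_aboveI[of _ "a + q * (1/2)"] bound)
  moreover have "(\<Sum>\<^sub>\<infinity>\<alpha>\<in>multi_indices n. cmod (c \<alpha> * monomial n z \<alpha>)) \<le> a + q * (1/2)"
    by (rule infsum_le_finite_sums[OF summable bound])
  moreover have "a + q * (1/2) < 1"
  proof -
    have "0 < (1 - a)\<^sup>2" using a by simp
    hence "2 * a < 1 + a\<^sup>2" by (simp add: power2_diff)
    thus ?thesis unfolding q_def by argo
  qed
  ultimately show "(\<lambda>\<alpha>. cmod (c \<alpha> * monomial n z \<alpha>)) summable_on multi_indices n \<and>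
      (\<Sum>\<^sub>\<infinity>\<alpha>\<in>multi_indices n. cmod (c \<alpha> * monomial n z \<alpha>)) < 1"
    by linarith
qed

section \<open>A multilinear form with small supremum and unimodular coefficients\<close>

text \<open>
With \<open>w\<^sub>x\<close> the \<open>x\<close>-th of the \<open>m\<close>-th roots of unity, the coefficient attached to
\<open>(a\<^sub>0, \<dots>, a\<^sub>k\<^sub>-\<^sub>1)\<close> is the product of the powers of \<open>w\<^sub>a\<close> with \<open>a = a\<^sub>i\<close> and exponent \<open>a\<^sub>i\<^sub>+\<^sub>1\<close>, where
the tuple is continued by \<open>a\<^sub>k = b\<close>. Neighbouring indices are thus coupled by the matrix of the
discrete Fourier transform; the free end \<open>b\<close> allows induction on \<open>k\<close>, and for \<open>b = 0\<close> the last
factor is 1.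
\<close>

definition chain_coeff :: "nat \<Rightarrow> nat \<Rightarrow> nat \<Rightarrow> (nat \<Rightarrow> nat) \<Rightarrow> complex" where
  "chain_coeff m k b a = (\<Prod>i<k. root_of_unity m (a i) ^ (a(k := b)) (Suc i))"

definition chain_form :: "nat \<Rightarrow> nat \<Rightarrow> (nat \<Rightarrow> nat \<Rightarrow> complex) \<Rightarrow> nat \<Rightarrow> complex" where
  "chain_form m k y b = (\<Sum>a\<in>{..<k} \<rightarrow>\<^sub>E {..<m}. chain_coeff m k b a * (\<Prod>i<k. y i (a i)))"

lemma norm_chain_coeff [simp]: "cmod (chain_coeff m k b a) = 1"
  by (simp add: chain_coeff_def prod_norm[symmetric] norm_power)

lemma chain_form_0: "chain_form m 0 y b = 1"
  by (simp add: chain_form_def chain_coeff_def)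

text \<open>
The form in \<open>k + 1\<close> groups of variables is the Fourier transform of the form in \<open>k\<close> groups after
entrywise multiplication by the new variables.
\<close>

lemma chain_form_Suc:
  "chain_form m (Suc k) y b = (\<Sum>x<m. (y k x * chain_form m k y x) * root_of_unity m x ^ b)"
proof -
  let ?P = "{..<k} \<rightarrow>\<^sub>E {..<m}"
  have P: "{..<Suc k} \<rightarrow>\<^sub>E {..<m} = (\<lambda>(x, a). a(k := x)) ` ({..<m} \<times> ?P)"
    unfolding lessThan_Suc by (rule PiE_insert_eq)
  have inj: "inj_on (\<lambda>(x, a). a(k := x)) ({..<m} \<times> ?P)"
    by (rule inj_combinator) simp
  have coeff: "chain_coeff m (Suc k) b (a(k := x)) = chain_coeff m k x a * root_of_unity m x ^ b" for a x
  proof -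
    have "(\<Prod>i<k. root_of_unity m ((a(k := x)) i) ^ (a(k := x, Suc k := b)) (Suc i)) = chain_coeff m k x a"
      unfolding chain_coeff_def by (intro prod.cong refl) auto
    thus ?thesis
      unfolding chain_coeff_def[of m "Suc k"] prod.lessThan_Suc by (simp only: fun_upd_same)
  qed
  have var: "(\<Prod>i<Suc k. y i ((a(k := x)) i)) = (\<Prod>i<k. y i (a i)) * y k x" for a x
  proof -
    have "(\<Prod>i<k. y i ((a(k := x)) i)) = (\<Prod>i<k. y i (a i))"
      by (intro prod.cong refl) auto
    thus ?thesis
      unfolding prod.lessThan_Suc by (simp only: fun_upd_same)
  qed
  have "chain_form m (Suc k) y b
      = (\<Sum>x<m. \<Sum>a\<in>?P. (y k x * root_of_unity m x ^ b) * (chain_coeff m k x a * (\<Prod>i<k. y i (a i))))"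
    unfolding chain_form_def P sum.reindex[OF inj] sum.cartesian_product
    by (intro sum.cong refl) (simp add: coeff var mult_ac case_prod_unfold del: fun_upd_apply prod.lessThan_Suc)
  thus ?thesis
    by (simp add: chain_form_def sum_distrib_left sum_distrib_right mult_ac)
qed

text \<open>
Up to the factor \<open>sqrt m\<close> the Fourier transform is an isometry, and multiplication by entries of
absolute value at most 1 is a contraction.
\<close>

lemma sum_square_chain_form:
  assumes y: "\<And>i x. i < k \<Longrightarrow> x < m \<Longrightarrow> cmod (y i x) \<le> 1"
  shows "(\<Sum>b<m. (cmod (chain_form m k y b))\<^sup>2) \<le> real m ^ (k + 1)"
  using assms
proof (induction k)
  case 0
  thus ?case by (simp add: chain_form_0)
next
  case (Suc k)
  have "(\<Sum>b<m. (cmod (chain_form m (Suc k) y b))\<^sup>2)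
      = real m * (\<Sum>x<m. (cmod (y k x * chain_form m k y x))\<^sup>2)"
    unfolding chain_form_Suc
  proof (rule parseval_orthogonal)
    fix x x' assume "x \<in> {..<m}" "x' \<in> {..<m}"
    thus "(\<Sum>b<m. root_of_unity m x ^ b * cnj (root_of_unity m x' ^ b))
        = (if x = x' then of_real (real m) else 0)"
      unfolding root_of_unity_power_commute[of m x] root_of_unity_power_commute[of m x']
      by (intro root_of_unity_orthogonal) auto
  qed simp
  also have "\<dots> \<le> real m * (\<Sum>x<m. (cmod (chain_form m k y x))\<^sup>2)"
    using Suc.prems
    by (intro mult_left_mono sum_mono power_mono) (auto simp: norm_mult intro!: mult_left_le_one_le)
  also have "\<dots> \<le> real m * real m ^ (k + 1)"
    using Suc by (intro mult_left_mono) auto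
  finally show ?case by simp
qed

lemma norm_chain_form_le:
  assumes "\<And>i x. i < k \<Longrightarrow> x < m \<Longrightarrow> cmod (y i x) \<le> 1" "b < m"
  shows "cmod (chain_form m k y b) \<le> sqrt (real m ^ (k + 1))"
proof (rule real_le_rsqrt)
  have "(cmod (chain_form m k y b))\<^sup>2 \<le> (\<Sum>b<m. (cmod (chain_form m k y b))\<^sup>2)"
    using assms(2) by (intro member_le_sum) auto
  also have "\<dots> \<le> real m ^ (k + 1)" using assms(1) by (rule sum_square_chain_form)
  finally show "(cmod (chain_form m k y b))\<^sup>2 \<le> real m ^ (k + 1)" .
qed

text \<open>
The first \<open>k * m\<close> of the \<open>n\<close> variables are cut into \<open>k\<close> blocks of length \<open>m\<close>. A tuple \<open>a\<close> picks the
variable in position \<open>a i\<close> of each block \<open>i\<close>, which makes a squarefree monomial.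
\<close>

definition block_index :: "nat \<Rightarrow> nat \<Rightarrow> nat \<Rightarrow> (nat \<Rightarrow> nat) \<Rightarrow> nat \<Rightarrow> nat" where
  "block_index n m k a = restrict (\<lambda>j. if j \<in> (\<lambda>i. i * m + a i) ` {..<k} then 1 else 0) {..<n}"

lemma block_position_eq:
  assumes "a < m" "a' < m" "i * m + a = i' * m + (a' :: nat)"
  shows "i = i' \<and> a = a'"
proof -
  have "i = (i * m + a) div m" "i' = (i' * m + a') div m" using assms(1,2) by auto
  thus ?thesis using assms(3) by auto
qed

lemma block_position_less:
  assumes "a < m" "i < k" "k * m \<le> n"
  shows "i * m + a < (n :: nat)"
proof -
  have "i * m + a < Suc i * m" using assms by simp
  also have "\<dots> \<le> k * m" using assms by (intro mult_right_mono) auto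
  finally show ?thesis using assms by simp
qed

lemma block_index_in [simp]: "block_index n m k a \<in> multi_indices n"
  by (auto simp: multi_indices_def block_index_def)

lemma inj_on_block_index:
  assumes "k * m \<le> n"
  shows "inj_on (block_index n m k) ({..<k} \<rightarrow>\<^sub>E {..<m})"
proof (rule inj_onI, rule PiE_ext)
  fix a a' i
  assume a: "a \<in> {..<k} \<rightarrow>\<^sub>E {..<m}" and a': "a' \<in> {..<k} \<rightarrow>\<^sub>E {..<m}"
    and eq: "block_index n m k a = block_index n m k a'" and i: "i \<in> {..<k}"
  have less: "i * m + a i < n"
    using a i assms by (intro block_position_less) auto
  have "block_index n m k a (i * m + a i) = 1"
    using i less by (auto simp: block_index_def)
  hence "block_index n m k a' (i * m + a i) = 1" by (simp add: eq)
  then obtain i' where i': "i' < k" "i * m + a i = i' * m + a' i'"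
    using less by (auto simp: block_index_def split: if_splits)
  have "a i < m" "a' i' < m" using a a' i i' by auto
  from block_position_eq[OF this i'(2)] show "a i = a' i" by auto
qed auto

lemma monomial_block_index:
  assumes "k * m \<le> n" and a: "a \<in> {..<k} \<rightarrow>\<^sub>E {..<m}"
  shows "monomial n z (block_index n m k a) = (\<Prod>i<k. z (i * m + a i))"
proof -
  let ?J = "(\<lambda>i. i * m + a i) ` {..<k}"
  have J: "?J \<subseteq> {..<n}"
    using assms by (auto intro!: block_position_less)
  have inj: "inj_on (\<lambda>i. i * m + a i) {..<k}"
  proof (rule inj_onI)
    fix i i' assume "i \<in> {..<k}" "i' \<in> {..<k}" and eq: "i * m + a i = i' * m + a i'"
    hence "a i < m" "a i' < m" using a by auto
    from block_position_eq[OF this eq] show "i = i'" by simp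
  qed
  have "monomial n z (block_index n m k a) = (\<Prod>j\<in>?J. z j)"
    unfolding monomial_def using J
    by (intro prod.mono_neutral_cong_right) (auto simp: block_index_def)
  also have "\<dots> = (\<Prod>i<k. z (i * m + a i))"
    by (simp add: prod.reindex[OF inj])
  finally show ?thesis .
qed

lemma has_sum_finite_image:
  fixes f :: "'b \<Rightarrow> 'c :: {comm_monoid_add, topological_space}"
  assumes "finite P" "inj_on e P" "e ` P \<subseteq> I" "\<And>\<alpha>. \<alpha> \<notin> e ` P \<Longrightarrow> f \<alpha> = 0"
  shows "(f has_sum (\<Sum>a\<in>P. f (e a))) I"
proof -
  have "(f has_sum (\<Sum>\<alpha>\<in>e ` P. f \<alpha>)) (e ` P)"
    using assms(1) by (intro has_sum_finite) auto
  also have "?this \<longleftrightarrow> (f has_sum (\<Sum>\<alpha>\<in>e ` P. f \<alpha>)) I"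
    using assms(3,4) by (intro has_sum_cong_neutral) auto
  finally show ?thesis
    by (simp add: sum.reindex[OF assms(2)])
qed

text \<open>
The multilinear form in the \<open>k\<close> blocks has \<open>m\<^sup>k\<close> coefficients of absolute value 1, so the sum of the
absolute values of its terms at radius \<open>r\<close> is \<open>(m r)\<^sup>k\<close>, while its supremum on the unit polydisc is
at most \<open>M = sqrt (m\<^sup>k\<^sup>+\<^sup>1)\<close>.
\<close>

lemma bohr_property_imp_block_bound:
  assumes bohr: "bohr_property n r" and r: "r > 0" and m: "m > 0" and km: "k * m \<le> n"
  shows "(real m * r) ^ k \<le> sqrt (real m ^ (k + 1))"
proof -
  define M where "M = sqrt (real m ^ (k + 1))"
  have M: "M > 0" using m by (simp add: M_def)
  let ?P = "{..<k} \<rightarrow>\<^sub>E {..<m}"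
  let ?e = "block_index n m k"
  have P: "finite ?P" by (intro finite_PiE) auto
  have inj: "inj_on ?e ?P" using km by (rule inj_on_block_index)
  \<comment> \<open>One factor \<open>\<theta>\<close> makes the supremum strictly smaller than 1, the other one moves the point into the open polydisc of radius \<open>r\<close>.\<close>
  have scaled: "\<theta> * (real m * (\<theta> * r)) ^ k \<le> M" if \<theta>: "0 < \<theta>" "\<theta> < 1" for \<theta>
  proof -
    define c where "c \<alpha> = (if \<alpha> \<in> ?e ` ?P then
      of_real (\<theta> / M) * chain_coeff m k 0 (inv_into ?P ?e \<alpha>) else 0)" for \<alpha>
    have c: "c (?e a) = of_real (\<theta> / M) * chain_coeff m k 0 a" if "a \<in> ?P" for a
      using that inj by (simp add: c_def)
    have c0: "c \<alpha> = 0" if "\<alpha> \<notin> ?e ` ?P" for \<alpha>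
      using that by (simp only: c_def if_False)
    have e: "?e ` ?P \<subseteq> multi_indices n" by (intro image_subsetI block_index_in)
    have "(\<lambda>\<alpha>. c \<alpha> * monomial n z \<alpha>) summable_on multi_indices n \<and>
        cmod (\<Sum>\<^sub>\<infinity>\<alpha>\<in>multi_indices n. c \<alpha> * monomial n z \<alpha>) < 1" if z: "z \<in> polydisc n 1" for z
    proof -
      define y where "y i x = z (i * m + x)" for i x
      have y: "cmod (y i x) \<le> 1" if "i < k" "x < m" for i x
        using z block_position_less[OF that(2,1) km] by (auto simp: polydisc_def y_def less_imp_le)
      have "(\<Sum>a\<in>?P. c (?e a) * monomial n z (?e a)) = of_real (\<theta> / M) * chain_form m k y 0"
        unfolding chain_form_def sum_distrib_left
        by (intro sum.cong refl) (simp add: c monomial_block_index[OF km] y_def)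
      hence sum: "((\<lambda>\<alpha>. c \<alpha> * monomial n z \<alpha>) has_sum (of_real (\<theta> / M) * chain_form m k y 0)) (multi_indices n)"
        using has_sum_finite_image[OF P inj e, of "\<lambda>\<alpha>. c \<alpha> * monomial n z \<alpha>"] c0 by simp
      have "cmod (of_real (\<theta> / M) * chain_form m k y 0) = \<theta> / M * cmod (chain_form m k y 0)"
        unfolding norm_mult norm_of_real using \<theta> M by simp
      also have "\<dots> \<le> \<theta> / M * M"
        unfolding M_def using y m \<theta> by (intro mult_left_mono norm_chain_form_le) auto
      also have "\<dots> < 1" using M \<theta> by simp
      finally show ?thesis
        using sum by (simp add: infsumI has_sum_imp_summable)
    qed
    moreover have "cmod (of_real (\<theta> * r)) < r"
      unfolding norm_of_real using \<theta> r by simp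
    hence "(\<lambda>_. of_real (\<theta> * r)) \<in> polydisc n r"
      by (simp add: polydisc_def del: of_real_mult)
    ultimately have "(\<Sum>\<^sub>\<infinity>\<alpha>\<in>multi_indices n. cmod (c \<alpha> * monomial n (\<lambda>_. of_real (\<theta> * r)) \<alpha>)) < 1"
      using bohr unfolding bohr_property_def by blast
    also have "(\<Sum>\<^sub>\<infinity>\<alpha>\<in>multi_indices n. cmod (c \<alpha> * monomial n (\<lambda>_. of_real (\<theta> * r)) \<alpha>))
        = (\<Sum>a\<in>?P. cmod (c (?e a) * monomial n (\<lambda>_. of_real (\<theta> * r)) (?e a)))"
      using c0 by (intro infsumI has_sum_finite_image[OF P inj e]) simp
    also have "\<dots> = (\<Sum>a\<in>?P. \<theta> / M * (\<theta> * r) ^ k)"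
    proof (intro sum.cong refl)
      fix a assume a: "a \<in> ?P"
      show "cmod (c (?e a) * monomial n (\<lambda>_. of_real (\<theta> * r)) (?e a)) = \<theta> / M * (\<theta> * r) ^ k"
        unfolding c[OF a] monomial_block_index[OF km a] prod_constant norm_mult norm_power norm_of_real
        using \<theta> M r by simp
    qed
    also have "\<dots> = \<theta> * (real m * (\<theta> * r)) ^ k / M"
      by (simp add: card_funcsetE power_mult_distrib)
    finally show ?thesis using M by (simp add: field_simps)
  qed
  have "((\<lambda>\<theta>. \<theta> * (real m * (\<theta> * r)) ^ k) \<longlongrightarrow> 1 * (real m * (1 * r)) ^ k) (at_left 1)"
    by (intro tendsto_intros)
  moreover have "eventually (\<lambda>\<theta>. \<theta> * (real m * (\<theta> * r)) ^ k \<le> M) (at_left 1)"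
    unfolding eventually_at_left_field using scaled by (auto intro!: exI[of _ 0])
  ultimately show ?thesis
    unfolding M_def[symmetric] by (force dest: tendsto_upperbound)
qed

section \<open>The upper bound\<close>

lemma bohr_property_imp_square_le:
  assumes bohr: "bohr_property n r" and r: "r > 0" and m: "m > 0" and km: "k * m \<le> n"
  shows "(real m * r\<^sup>2) ^ k \<le> real m"
proof -
  have "((real m * r) ^ k)\<^sup>2 \<le> (sqrt (real m ^ (k + 1)))\<^sup>2"
    using bohr_property_imp_block_bound[OF assms] r by (intro power_mono) auto
  also have "(sqrt (real m ^ (k + 1)))\<^sup>2 = real m ^ k * real m"
    by simp
  also have "((real m * r) ^ k)\<^sup>2 = real m ^ k * (real m * r\<^sup>2) ^ k"
    by (simp add: power_mult_distrib power2_eq_square mult_ac)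
  finally show ?thesis
    using m by (subst (asm) mult_le_cancel_left_pos) auto
qed

lemma ln_ge_of_power_le:
  fixes q y :: real
  assumes "exp 1 \<le> q" "q ^ k \<le> y"
  shows "real k \<le> ln y"
proof -
  have "exp (real k) = exp 1 ^ k" by (simp flip: exp_of_nat_mult)
  also have "\<dots> \<le> q ^ k" using assms by (intro power_mono) auto
  also have "\<dots> \<le> y" by fact
  finally have "exp (real k) \<le> y" .
  thus ?thesis using exp_gt_zero[of "real k"] by (subst ln_ge_iff) linarith+
qed

lemma exp_1_bounds: "(27/10 :: real) \<le> exp 1" "exp 1 \<le> (272/100 :: real)"
  using e_approx_32 by (simp_all add: abs_if split: if_splits)

lemma ln_ge_nat:
  assumes "(272/100) ^ k \<le> real n"
  shows "real k \<le> ln (real n)"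
  using exp_1_bounds(2) assms by (rule ln_ge_of_power_le)

lemma ln_ge_three_halves:
  fixes n :: nat
  assumes "n \<ge> 5"
  shows "3/2 \<le> ln (real n)"
proof -
  have "(5 :: real)\<^sup>2 \<le> (real n)\<^sup>2" using assms by (intro power_mono) auto
  hence "(272/100) ^ 3 \<le> (real n)\<^sup>2" by (simp add: power3_eq_cube)
  hence "real 3 \<le> ln ((real n)\<^sup>2)" by (rule ln_ge_of_power_le[OF exp_1_bounds(2)])
  thus ?thesis using assms by (simp add: ln_realpow)
qed

text \<open>
This is what contradicts the block condition for two blocks of length at least \<open>(n - 1) / 2\<close>.
On each range of \<open>n\<close> a constant lower bound \<open>l\<close> of the logarithm suffices: the difference of the two
sides is then a quadratic polynomial in \<open>n\<close> that has the right sign between the ends of the range.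
\<close>

lemma two_blocks_inequality:
  fixes n :: nat
  assumes "3 \<le> n" "n < 55"
  shows "(real n)\<^sup>2 < 8 * (ln (real n))\<^sup>2 * (real n - 1)"
proof -
  have *: ?thesis if "l \<ge> 0" "l \<le> ln (real n)" "(real n)\<^sup>2 < 8 * l\<^sup>2 * (real n - 1)" for l
  proof -
    have "8 * l\<^sup>2 * (real n - 1) \<le> 8 * (ln (real n))\<^sup>2 * (real n - 1)"
      using that assms by (intro mult_left_mono mult_right_mono power_mono) auto
    thus ?thesis using that by linarith
  qed
  consider "n \<in> {3..6}" | "n = 7" | "n \<in> {8..20}" | "n \<in> {21..54}" using assms by force
  thus ?thesis
  proof cases
    case 1
    have "(real n - 3) * (real n - 6) \<le> 0" using 1 by (intro mult_nonneg_nonpos) auto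
    thus ?thesis using 1 ln_ge_nat[of 1 n] by (intro *[of 1]) (auto simp: power2_eq_square power3_eq_cube algebra_simps)
  next
    case 2
    thus ?thesis using ln_ge_three_halves[of n] by (intro *[of "3/2"]) (auto simp: power2_eq_square)
  next
    case 3
    have "(real n - 8) * (real n - 20) \<le> 0" using 3 by (intro mult_nonneg_nonpos) auto
    thus ?thesis using 3 ln_ge_nat[of 2 n] by (intro *[of 2]) (auto simp: power2_eq_square power3_eq_cube algebra_simps)
  next
    case 4
    have "(real n - 21) * (real n - 54) \<le> 0" using 4 by (intro mult_nonneg_nonpos) auto
    thus ?thesis using 4 ln_ge_nat[of 3 n] by (intro *[of 3]) (auto simp: power2_eq_square power3_eq_cube algebra_simps)
  qed
qed

text \<open>
With blocks of length \<open>m = n div k\<close> the condition is \<open>(m r\<^sup>2)\<^sup>k \<le> m\<close>, where \<open>m r\<^sup>2\<close> is roughly at least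
\<open>4 (ln n) / k\<close>. The choice \<open>k \<approx> ln n\<close> makes this close to 4, and being larger than \<open>exp 1\<close> suffices for a
contradiction, as \<open>(exp 1)\<^sup>k \<ge> n\<close>. The distance from \<open>exp 1\<close> to 4 pays for rounding \<open>k\<close> and \<open>m\<close> once
\<open>n \<ge> 55 > exp 4\<close>. For smaller \<open>n\<close> two blocks are enough, except that for \<open>n = 2\<close> the claimed bound
exceeds 1.
\<close>

lemma not_bohr_property_of_square_ge:
  fixes n :: nat
  assumes n: "n > 1" and r: "r > 0" "r\<^sup>2 \<ge> 4 * ln (real n) / real n"
  shows "\<not> bohr_property n r"
proof
  assume bohr: "bohr_property n r"
  define L where "L = ln (real n)"
  have L: "L > 0" using n by (simp add: L_def)
  consider "n = 2" | "3 \<le> n" "n < 55" | "n \<ge> 55" using n by linarith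
  thus False
  proof cases
    case 1
    have "1 < r\<^sup>2" using r(2) ln2_ge_two_thirds 1 by simp
    moreover have "r\<^sup>2 \<le> 1"
      using bohr_property_le_1[OF _ bohr] n r by (simp add: power_le_one)
    ultimately show False by simp
  next
    case 2
    define m where "m = n div 2"
    have m: "m > 0" "2 * m \<le> n" using 2 by (auto simp: m_def)
    have "n \<le> 2 * m + 1" unfolding m_def by presburger
    hence "real n \<le> real (2 * m + 1)" by (simp only: of_nat_le_iff)
    hence m': "real m \<ge> (real n - 1) / 2" by simp
    have "(real m * (4 * L / real n))\<^sup>2 \<le> (real m * r\<^sup>2)\<^sup>2"
      using r L unfolding L_def by (intro power_mono mult_left_mono) auto
    also have "\<dots> \<le> real m"
      by (rule bohr_property_imp_square_le[OF bohr r(1) m])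
    finally have "real m * (real m * (16 * L\<^sup>2)) \<le> real m * (real n)\<^sup>2"
      using n by (simp add: power2_eq_square field_simps)
    hence "real m * (16 * L\<^sup>2) \<le> (real n)\<^sup>2"
      using m by (subst (asm) mult_le_cancel_left_pos) auto
    moreover have "(real n - 1) / 2 * (16 * L\<^sup>2) \<le> real m * (16 * L\<^sup>2)"
      using m' by (intro mult_right_mono) auto
    ultimately show False
      using two_blocks_inequality[OF 2] by (simp add: L_def mult_ac)
  next
    case 3
    have L4: "L \<ge> 4" using ln_ge_nat[of 4 n] 3 by (simp add: L_def power4_eq_xxxx)
    define k where "k = nat \<lceil>L\<rceil>"
    have k: "L \<le> real k" "real k < L + 1" using L unfolding k_def by linarith+
    have k0: "k > 0" using k(1) L by (cases k) auto
    define m where "m = n div k"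
    have km: "k * m \<le> n" by (simp add: m_def)
    have "n < k * (m + 1)"
      using k0 dividend_less_times_div[of k n] by (simp add: m_def)
    hence "real n < real (k * (m + 1))" by (simp only: of_nat_less_iff)
    hence "real n / real k < real m + 1" using k0 by (simp add: field_simps)
    define q where "q = real m * (4 * L / real n)"
    \<comment> \<open>Any slope below \<open>0.12\<close> would make \<open>q > exp 1\<close> below; this one follows from the tangent of \<open>ln\<close> at \<open>exp 4\<close>.\<close>
    have ln_n: "L \<le> 1/12 * real n"
    proof -
      have "50 \<le> (27/10 :: real) ^ 4" by (simp add: power4_eq_xxxx)
      also have "\<dots> \<le> exp 1 ^ 4" using exp_1_bounds by (intro power_mono) auto
      also have "\<dots> = exp (4 :: real)" by (simp flip: exp_of_nat_mult)
      finally have e4: "50 \<le> exp (4 :: real)" .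
      have "L - 4 = ln (real n / exp 4)" using 3 by (simp add: L_def ln_div)
      also have "\<dots> \<le> real n / exp 4 - 1" using 3 by (intro ln_le_minus_one) simp
      also have "real n / exp 4 \<le> real n / 50" using e4 by (intro divide_left_mono) auto
      finally show ?thesis using 3 by simp
    qed
    have "q > exp 1"
    proof -
      have "16/5 \<le> 4 * L / (L + 1)" using L4 by (simp add: field_simps)
      also have "\<dots> \<le> 4 * L / real k" using k L k0 by (intro divide_left_mono) auto
      also have "\<dots> = (4 * L / real n) * (real n / real k)" using 3 by simp
      also have "\<dots> < (4 * L / real n) * (real m + 1)"
        using \<open>real n / real k < real m + 1\<close> L 3 by (intro mult_strict_left_mono) auto
      also have "\<dots> = q + 4 * L / real n" by (simp add: q_def algebra_simps add_divide_distrib)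
      also have "4 * L / real n \<le> 4/12" using ln_n 3 by (simp add: field_simps)
      finally show ?thesis using exp_1_bounds by simp
    qed
    have m: "m > 0"
      using \<open>q > exp 1\<close> by (cases "m = 0") (auto simp: q_def)
    have "q ^ k \<le> (real m * r\<^sup>2) ^ k"
      unfolding q_def using r L by (intro power_mono mult_left_mono) (auto simp: L_def)
    also have "\<dots> \<le> real m"
      by (rule bohr_property_imp_square_le[OF bohr r(1) m km])
    finally have "real k \<le> ln (real m)"
      using \<open>q > exp 1\<close> by (intro ln_ge_of_power_le[of q]) auto
    also have "m < n" unfolding m_def using k L4 3 by (intro div_less_dividend) auto
    hence "ln (real m) < L" using m by (simp add: L_def)
    finally show False using k by simp
  qed
qed

section \<open>Both bounds\<close>

theorem theorem2:
  fixes n :: nat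
  assumes "n > 1"
  shows "1 / (3 * sqrt (real n)) < bohr_radius n \<and>
         bohr_radius n < 2 * sqrt (ln (real n)) / sqrt (real n)"
proof
  have n: "0 < n" "2 \<le> n" using assms by auto
  have "1 / (3 * sqrt (real n)) < 17 / (50 * sqrt (real n))"
    using n by (simp add: field_simps)
  also have "\<dots> \<le> bohr_radius n"
    by (intro bohr_radius_greatest(2) bohr_property_lower n refl)
  finally show lower: "1 / (3 * sqrt (real n)) < bohr_radius n" .
  have pos: "0 < bohr_radius n"
    using lower n by (meson divide_pos_pos less_trans mult_pos_pos of_nat_0_less_iff real_sqrt_gt_zero zero_less_numeral zero_less_one)
  have "(bohr_radius n)\<^sup>2 < 4 * ln (real n) / real n"
    using not_bohr_property_of_square_ge[OF assms pos] bohr_radius_greatest(1)[OF n(1)] by force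
  also have "\<dots> = (2 * sqrt (ln (real n)) / sqrt (real n))\<^sup>2"
    using assms by (simp add: power_divide power_mult_distrib)
  finally show "bohr_radius n < 2 * sqrt (ln (real n)) / sqrt (real n)"
    by (rule power2_less_imp_less) (use assms in auto)
qed

end
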